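(* Let $k$ be a positive integer, $h:[n]\to(0,1)$ any hash function, and let $A_0,A_1,A_2$ be pairwise disjoint streams (no identifier occurs in two of them), with $A_1$ containing at least $k$ distinct identifiers, and let $A^*=A_0\circ A_1\circ A_2$ be their concatenation. Then $$\mathrm{AlphaTCF}(k,A^*,h)\le \mathrm{AlphaTCF}(k,A_1,h).$$
   Context: Identifiers come from $[n]$; a stream is a finite sequence of identifiers; $\circ$ denotes concatenation; $h(A)$ is the sequence of hash values in stream order (hash values are assumed distinct for distinct identifiers). AlphaTCF$(k,A,h)$: set $\alpha=k/(k+1)$; let the prefix be the shortest prefix of $h(A)$ containing exactly $k$ distinct hash values and the suffix the rest; $D$ := set of distinct hash values in the prefix; $i:=0$; for each $x$ in the suffix, in order: if $x<\alpha^i$ and $x\notin D$, then $i:=i+1$ and $D:=D\cup\{x\}$. Return $\theta=\alpha^i$. *)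

theory Defs
  imports Complex_Main
begin

text \<open>
  Length of the shortest prefix containing exactly \<open>k\<close> distinct values. If the list has fewer than
  \<open>k\<close> distinct values there is no such prefix and the result is unspecified.
\<close>

definition prefix_length :: "nat \<Rightarrow> real list \<Rightarrow> nat" where
  "prefix_length k xs = (LEAST m. m \<le> length xs \<and> card (set (take m xs)) = k)"

definition alphaTCF_step :: "real \<Rightarrow> real \<Rightarrow> nat \<times> real set \<Rightarrow> nat \<times> real set" where
  "alphaTCF_step \<alpha> x = (\<lambda>(i, D). if x < \<alpha> ^ i \<and> x \<notin> D then (i + 1, D \<union> {x}) else (i, D))"

definition AlphaTCF :: "nat \<Rightarrow> 'a list \<Rightarrow> ('a \<Rightarrow> real) \<Rightarrow> real" where
  "AlphaTCF k A h =
    (let \<alpha> = real k / (real k + 1);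
         xs = map h A;
         m = prefix_length k xs;
         (i, D) = fold (alphaTCF_step \<alpha>) (drop m xs) (0, set (take m xs))
     in \<alpha> ^ i)"

end

theory Submission
  imports Defs
begin

text \<open>
  Compare the two runs from the end of the prefix of \<open>A\<^sub>1\<close> on. By then the run on
  \<open>A\<^sub>0 \<circ> A\<^sub>1 \<circ> A\<^sub>2\<close> has also completed its prefix, so its counter is at least \<open>0\<close>. From here on both
  runs read the rest of \<open>A\<^sub>1\<close>, and the counter \<open>i\<close> of the run on \<open>A\<^sub>1\<close> never overtakes the counter
  \<open>j\<close> of the other: overtaking needs \<open>i = j\<close> and a value \<open>x < \<alpha>\<^sup>i\<close> that only the first run accepts,
  hence one which the other run has already stored; but \<open>x\<close> does not come from \<open>A\<^sub>0\<close>, and a value of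
  \<open>A\<^sub>1\<close> read earlier is either stored in the first run too or was rejected there for being too
  large, and thresholds only decrease.
\<close>

text \<open>Appending one element raises the number of distinct values by at most one, so no count
  is skipped.\<close>

lemma ex_prefix_card:
  assumes "k \<le> card (set xs)"
  shows "\<exists>m\<le>length xs. card (set (take m xs)) = k"
  using assms
proof (induction xs rule: rev_induct)
  case (snoc x xs)
  show ?case
  proof (cases "k \<le> card (set xs)")
    case True
    with snoc.IH obtain m where "m \<le> length xs" "card (set (take m xs)) = k" by blast
    then show ?thesis by (intro exI[of _ m]) simp
  next
    case False
    with snoc.prems have "card (set (xs @ [x])) = k"
      by (auto simp: card_insert_if split: if_splits)
    then show ?thesis by (intro exI[of _ "Suc (length xs)"]) simp
  qed
qed auto

lemma card_prefix:
  assumes "k \<le> card (set xs)"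
  shows "card (set (take (prefix_length k xs) xs)) = k"
proof -
  obtain m where "m \<le> length xs \<and> card (set (take m xs)) = k"
    using ex_prefix_card[OF assms] by blast
  from LeastI[of "\<lambda>m. m \<le> length xs \<and> card (set (take m xs)) = k", OF this]
  show ?thesis by (simp add: prefix_length_def)
qed

lemma prefix_length_append_le:
  assumes "k \<le> card (set ys)"
  shows "prefix_length k (ys @ zs) \<le> length ys"
proof -
  obtain m where m: "m \<le> length ys" "card (set (take m ys)) = k"
    using ex_prefix_card[OF assms] by blast
  have "prefix_length k (ys @ zs) \<le> m"
    unfolding prefix_length_def by (rule Least_le) (use m in simp)
  with m show ?thesis by simp
qed

lemma alphaTCF_step_mono: "fst s \<le> fst (alphaTCF_step \<alpha> x s)"
  by (cases s) (simp add: alphaTCF_step_def)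

lemma fold_alphaTCF_step_mono: "fst s \<le> fst (fold (alphaTCF_step \<alpha>) xs s)"
proof (induction xs arbitrary: s)
  case (Cons x xs)
  show ?case
    using order_trans[OF alphaTCF_step_mono Cons.IH] by simp
qed simp

lemma fold_alphaTCF_step_subset:
  "snd (fold (alphaTCF_step \<alpha>) xs s) \<subseteq> snd s \<union> set xs"
proof (induction xs arbitrary: s)
  case (Cons x xs)
  have "snd (alphaTCF_step \<alpha> x s) \<subseteq> insert x (snd s)"
    by (cases s) (auto simp: alphaTCF_step_def)
  with Cons.IH[of "alphaTCF_step \<alpha> x s"] show ?case by auto
qed simp

text \<open>\<open>H\<close> stands for the hash values of \<open>A0\<close>. The condition on
  \<open>E\<close> is the invariant: a value outside \<open>H\<close> that only the second run has
  stored is too large for the first run, now and at all later thresholds.\<close>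

lemma fold_alphaTCF_step_compare:
  assumes "0 \<le> \<alpha>" "\<alpha> \<le> 1"
    and "set xs \<inter> H = {}"
    and "i \<le> j" and "\<And>x. x \<in> E \<Longrightarrow> x \<in> H \<or> x \<in> D \<or> \<alpha> ^ i \<le> x"
  shows "fst (fold (alphaTCF_step \<alpha>) xs (i, D)) \<le> fst (fold (alphaTCF_step \<alpha>) xs (j, E))"
  using assms(3-)
proof (induction xs arbitrary: i j D E)
  case (Cons x xs)
  obtain i' D' j' E' where
    s: "alphaTCF_step \<alpha> x (i, D) = (i', D')" "alphaTCF_step \<alpha> x (j, E) = (j', E')"
    by fastforce
  have dec: "\<alpha> ^ Suc i \<le> \<alpha> ^ i"
    using assms(1,2) by (intro power_decreasing) auto
  have le: "i' \<le> j'"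
  proof (cases "i = j \<and> x < \<alpha> ^ i \<and> x \<notin> D")
    case True
    then have "x \<notin> E"
      using Cons.prems(1,3) by force
    with True s show ?thesis by (auto simp: alphaTCF_step_def split: if_splits)
  next
    case False
    with s Cons.prems(2) show ?thesis by (auto simp: alphaTCF_step_def split: if_splits)
  qed
  have E': "y \<in> H \<or> y \<in> D' \<or> \<alpha> ^ i' \<le> y" if "y \<in> E'" for y
  proof -
    have "\<alpha> ^ i' \<le> \<alpha> ^ i"
      using s dec by (auto simp: alphaTCF_step_def split: if_splits)
    \<comment> \<open>If \<open>x\<close> is missing from \<open>D'\<close>, the first run rejected
      it for its size, so \<open>i' = i\<close> and \<open>\<alpha> ^ i \<le> x\<close>.\<close>
    moreover have "y \<in> E \<or> y = x" "D \<subseteq> D'" "x \<in> D' \<or> \<alpha> ^ i' \<le> x"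
      using s that by (auto simp: alphaTCF_step_def split: if_splits)
    ultimately show ?thesis
      using Cons.prems(3)[of y] by auto
  qed
  show ?case
    using Cons.IH[OF _ le E'] Cons.prems(1) s by simp
qed simp

lemma AlphaTCF_eq:
  "AlphaTCF k A h = (let \<alpha> = real k / (real k + 1); xs = map h A; m = prefix_length k xs
     in \<alpha> ^ fst (fold (alphaTCF_step \<alpha>) (drop m xs) (0, set (take m xs))))"
  by (simp add: AlphaTCF_def Let_def case_prod_beta)

theorem theorem15:
  fixes k n :: nat
    and h :: "nat \<Rightarrow> real"
    and A0 A1 A2 :: "nat list"
  assumes "k > 0"
    and "h ` {1..n} \<subseteq> {0<..<1}"
    and "inj_on h {1..n}"
    and "set A0 \<subseteq> {1..n}" and "set A1 \<subseteq> {1..n}" and "set A2 \<subseteq> {1..n}"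
    and "set A0 \<inter> set A1 = {}" and "set A0 \<inter> set A2 = {}" and "set A1 \<inter> set A2 = {}"
    and "card (set A1) \<ge> k"
  shows "AlphaTCF k (A0 @ A1 @ A2) h \<le> AlphaTCF k A1 h"
proof -
  define \<alpha> where "\<alpha> = real k / (real k + 1)"
  have \<alpha>: "0 \<le> \<alpha>" "\<alpha> \<le> 1" by (simp_all add: \<alpha>_def)
  let ?f = "fold (alphaTCF_step \<alpha>)"
  define xs where "xs = map h A1"
  define m where "m = prefix_length k xs"
  \<comment> \<open>The long stream is cut where the prefix of \<open>A1\<close> ends; its own
    prefix ends within \<open>ys\<close>.\<close>
  define ys where "ys = map h A0 @ take m xs"
  define zs where "zs = drop m xs @ map h A2"
  define p where "p = prefix_length k (ys @ zs)"
  have concat: "map h (A0 @ A1 @ A2) = ys @ zs"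
    by (simp add: ys_def zs_def xs_def)
  \<comment> \<open>Injectivity of \<open>h\<close> gives \<open>k\<close> distinct hash values in
    \<open>A1\<close>, so its prefix exists.\<close>
  have "card (set xs) = card (set A1)"
    unfolding xs_def set_map by (rule card_image) (rule inj_on_subset[OF assms(3) assms(5)])
  then have "card (set (take m xs)) = k"
    unfolding m_def by (intro card_prefix) (simp add: assms(10))
  then have "k \<le> card (set ys)"
    by (metis List.finite_set card_mono set_append sup_ge2 ys_def)
  then have p: "p \<le> length ys"
    unfolding p_def by (rule prefix_length_append_le)
  have disj: "set (drop m xs) \<inter> h ` set A0 = {}"
  proof -
    have "h ` set A1 \<inter> h ` set A0 = h ` (set A1 \<inter> set A0)"
      using inj_on_image_Int[OF assms(3) assms(5,4)] by simp
    with assms(7) have "set xs \<inter> h ` set A0 = {}"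
      by (auto simp: xs_def)
    then show ?thesis
      using set_drop_subset[of m xs] by blast
  qed
  obtain j E where jE: "?f (drop p ys) (0, set (take p ys)) = (j, E)"
    by fastforce
  have "E \<subseteq> set (take p ys) \<union> set (drop p ys)"
    using fold_alphaTCF_step_subset[of \<alpha> "drop p ys" "(0, set (take p ys))"] jE by simp
  then have E: "E \<subseteq> h ` set A0 \<union> set (take m xs)"
    by (metis append_take_drop_id set_append set_map ys_def)
  \<comment> \<open>The invariant holds at the start: \<open>i = 0\<close>, and values of
    \<open>E\<close> come from \<open>A0\<close> or from the prefix of \<open>A1\<close>.\<close>
  have "fst (?f (drop m xs) (0, set (take m xs))) \<le> fst (?f (drop m xs) (j, E))"
    by (rule fold_alphaTCF_step_compare[OF \<alpha> disj]) (use E in auto)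
  also have "\<dots> \<le> fst (?f zs (j, E))"
    by (simp add: zs_def fold_alphaTCF_step_mono)
  also have "?f zs (j, E) = ?f (drop p (ys @ zs)) (0, set (take p (ys @ zs)))"
    using p jE by simp
  finally show ?thesis
    unfolding AlphaTCF_eq Let_def concat \<alpha>_def[symmetric] xs_def[symmetric] m_def[symmetric]
      p_def[symmetric]
    by (rule power_decreasing) (fact \<alpha>)+
qed

end
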